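(* Let $f(\mathbf{x}):=e^{\mathbf{1}^\top\mathbf{x}}-1$ on $\mathbb{R}^d$. (a) Let $k>0$ be fixed, and for $u>0$ let $\mathbf{v}_0:=ku\mathbf{1}\in\mathbb{R}^d_{>0}$ and $J:=\operatorname{conv}\{\mathbf{v}_0,\mathbf{v}_0-u\mathbf{e}_1,\dots,\mathbf{v}_0-u\mathbf{e}_d\}$. Then $$\lim_{u\to\infty}u^d\cdot\frac{\operatorname{vol}(P^0(f,J))-\operatorname{vol}(P(f,J))}{\operatorname{vol}(P^0(f,J))}=(d+1)!.$$ (b) Let $\mathbf{v}_0\in\mathbb{R}^d_{\ge0}\setminus\{\mathbf{0}\}$ be fixed and for $u>0$ let $J:=\operatorname{conv}\{\mathbf{v}_0,\mathbf{v}_0+u\mathbf{e}_1,\dots,\mathbf{v}_0+u\mathbf{e}_d\}$. Then $$\lim_{u\to\infty}u\cdot\frac{\operatorname{vol}(P^0(f,J))-\operatorname{vol}(P(f,J))}{\operatorname{vol}(P^0(f,J))}=d+1.$$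
   Context: $\mathbf{e}_j$ is the $j$-th unit vector and $\mathbf{1}$ the all-ones vector in $\mathbb{R}^d$. Let $\mu$ be the unique affine function agreeing with $f$ at the vertices of $J$ and $\mu(\mathbf{x},z):=z\mu(\mathbf{x}/z)$ (extended linearly in $(\mathbf{x},z)$). For $z\ge0$, $z\cdot J:=\{z\mathbf{x}:\mathbf{x}\in J\}$. Perspective relaxation: $P(f,J):=\operatorname{cl}\{(\mathbf{x},y,z)\in\mathbb{R}^d\times\mathbb{R}\times\mathbb{R}:\mu(\mathbf{x},z)\ge y\ge zf(\mathbf{x}/z),\ \mathbf{x}\in z\cdot J,\ 1\ge z>0\}$. Naive relaxation: $P^0(f,J):=\{(\mathbf{x},y,z)\in\mathbb{R}^d\times\mathbb{R}\times\mathbb{R}:\mu(\mathbf{x},z)\ge y\ge f(\mathbf{x}),\ \mathbf{x}\in z\cdot J,\ 1\ge z\ge0\}$. $\operatorname{vol}$ is $(d+2)$-dimensional Lebesgue measure. *)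

theory Defs
  imports "HOL-Analysis.Analysis"
begin

definition expf :: "real^'n \<Rightarrow> real" where
  "expf x = exp (\<Sum>i\<in>UNIV. x $ i) - 1"

definition affine_interp :: "(real^'n \<Rightarrow> real) \<Rightarrow> (real^'n) set \<Rightarrow> (real^'n \<Rightarrow> real)" where
  "affine_interp f V = (THE g. (\<exists>a b. g = (\<lambda>x. a \<bullet> x + b)) \<and> (\<forall>v\<in>V. g v = f v))"

text \<open>Homogenization mu(x,z) = z mu(x/z), extended linearly in (x,z):
  for affine g(x) = a.x + b this is a.x + b z.\<close>
definition persp_mu :: "(real^'n \<Rightarrow> real) \<Rightarrow> (real^'n) set \<Rightarrow> real^'n \<Rightarrow> real \<Rightarrow> real" where
  "persp_mu f V x z =
     affine_interp f V x - affine_interp f V 0 + z * affine_interp f V 0"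

definition persp_relax :: "(real^'n \<Rightarrow> real) \<Rightarrow> (real^'n) set \<Rightarrow> ((real^'n) \<times> real \<times> real) set" where
  "persp_relax f V = closure {(x, y, z). persp_mu f V x z \<ge> y \<and> y \<ge> z * f ((1 / z) *\<^sub>R x)
      \<and> x \<in> (\<lambda>w. z *\<^sub>R w) ` (convex hull V) \<and> z \<le> 1 \<and> 0 < z}"

definition naive_relax :: "(real^'n \<Rightarrow> real) \<Rightarrow> (real^'n) set \<Rightarrow> ((real^'n) \<times> real \<times> real) set" where
  "naive_relax f V = {(x, y, z). persp_mu f V x z \<ge> y \<and> y \<ge> f x
      \<and> x \<in> (\<lambda>w. z *\<^sub>R w) ` (convex hull V) \<and> z \<le> 1 \<and> 0 \<le> z}"

definition rel_gap :: "(real^'n \<Rightarrow> real) \<Rightarrow> (real^'n) set \<Rightarrow> real" where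
  "rel_gap f V = (measure lborel (naive_relax f V) - measure lborel (persp_relax f V))
                 / measure lborel (naive_relax f V)"

end

theory Submission
  imports Defs "HOL-Real_Asymp.Real_Asymp"
begin

text \<open>
  Both families of simplices have the form \<open>J = v + c \<Delta>\<close>, where \<open>\<Delta>\<close> is the standard simplex and
  \<open>c = -u\<close> in (a), \<open>c = u\<close> in (b). Put \<open>d = m + 1\<close> for the dimension and \<open>s = 1\<^sup>Tv\<close>. In the
  coordinates \<open>x = z (v + c t)\<close> all three functions bounding \<open>y\<close> depend on \<open>t\<close> only through
  \<open>r = 1\<^sup>Tt\<close>, whose distribution on \<open>\<Delta>\<close> has density \<open>r\<^sup>m / m!\<close> on \<open>[0, 1]\<close>. Hence, with
  \<open>F(a) = \<integral>\<^sub>0\<^sup>1 e\<^bsup>ar\<^esup> r\<^sup>m / m! dr\<close> and \<open>N = \<integral>\<^sub>0\<^sup>1 z\<^sup>d e\<^bsup>zs\<^esup> F(zc) dz\<close>, the difference of the volumes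
  divided by \<open>|c|\<^sup>d\<close> is \<open>e\<^sup>s F(c) / (d + 2) - N\<close> plus a constant, while the naive volume is
  dominated by its linear upper bound. In (a), \<open>u\<^sup>d F(-u) \<longrightarrow> 1\<close> and \<open>u\<^sup>d N \<le> e\<^sup>s / s\<close>; in (b),
  \<open>u e\<^bsup>-u\<^esup> F(u) \<longrightarrow> 1 / m!\<close> and \<open>N \<le> e\<^bsup>s+u\<^esup> / u\<^sup>2\<close>. So \<open>N\<close> is negligible in both cases.
\<close>

subsection \<open>Integration over the standard simplex\<close>

lemma sum_Basis_vec: "(\<Sum>b\<in>Basis. (x::real^'n) \<bullet> b) = (\<Sum>i\<in>UNIV. x $ i)"
proof -
  have B: "Basis = (\<lambda>i. axis i (1::real)) ` (UNIV::'n set)"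
    by (auto simp: Basis_vec_def)
  have "inj (\<lambda>i::'n. axis i (1::real))"
    by (auto simp: inj_on_def axis_eq_axis)
  then show ?thesis
    unfolding B by (subst sum.reindex) (simp_all add: inner_axis)
qed

lemma measurable_sum_vec [measurable]: "(\<lambda>t::real^'n. \<Sum>i\<in>UNIV. t $ i) \<in> borel_measurable borel"
  by (intro borel_measurable_continuous_onI continuous_intros)

text \<open>The scale is a parameter because the simplices of scale \<open>s\<close> are the
  sublevel sets of the coordinate sum: their volumes give its distribution function.\<close>

definition coord_simplex :: "real \<Rightarrow> (real^'n) set" where
  "coord_simplex s = {t. (\<forall>i. 0 \<le> t $ i) \<and> (\<Sum>i\<in>UNIV. t $ i) \<le> s}"

lemma coord_simplex_Basis:
  "coord_simplex s = {t::real^'n. (\<forall>b\<in>Basis. 0 \<le> t \<bullet> b) \<and> sum ((\<bullet>) t) Basis \<le> s}"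
  unfolding coord_simplex_def sum_Basis_vec by (auto simp: Basis_vec_def inner_axis)

lemma closed_coord_simplex: "closed (coord_simplex s)"
  unfolding coord_simplex_def
  by (intro closed_Collect_conj closed_Collect_all closed_Collect_le continuous_intros)

lemma coord_simplex_measurable [measurable]: "coord_simplex s \<in> sets borel"
  by (simp add: closed_coord_simplex borel_closed)

lemma convex_hull_coord_simplex:
  "convex hull (insert 0 (range (\<lambda>j. axis j 1))) = (coord_simplex 1 :: (real^'n) set)"
proof -
  have "range (\<lambda>j::'n. axis j (1::real)) = Basis"
    by (auto simp: Basis_vec_def)
  then show ?thesis
    by (simp add: std_simplex coord_simplex_Basis)
qed

text \<open>The known volume concerns coordinate functions under the product measure. Since
  \<open>lborel\<close> is the image of that measure, it suffices to identify the preimage.\<close>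

lemma emeasure_coord_simplex:
  assumes "0 \<le> s"
  shows "emeasure lborel (coord_simplex s :: (real^'n) set) = ennreal (s ^ CARD('n) / fact CARD('n))"
proof -
  have "emeasure lborel (coord_simplex s :: (real^'n) set) =
          emeasure (distr (Pi\<^sub>M Basis (\<lambda>b. lborel)) borel (\<lambda>f. \<Sum>b\<in>Basis. f b *\<^sub>R b))
            (coord_simplex s :: (real^'n) set)"
    by (subst lborel_eq) simp
  also have "\<dots> = emeasure (Pi\<^sub>M (Basis :: (real^'n) set) (\<lambda>b. lborel))
      ({y. (\<forall>i\<in>Basis. 0 \<le> y i) \<and> sum y Basis \<le> s} \<inter> space (Pi\<^sub>M Basis (\<lambda>b. lborel)))"
    by (subst emeasure_distr) (auto simp: coord_simplex_Basis intro!: arg_cong2[where f=emeasure])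
  also have "\<dots> = ennreal (s ^ CARD('n) / fact CARD('n))"
    using assms by (subst emeasure_std_simplex_aux) auto
  finally show ?thesis .
qed

text \<open>Reduces a d-dimensional integral to one variable: the image of Lebesgue measure on the
  simplex under the coordinate sum has density r^(d-1) / (d-1)! on [0, 1]. The two measures are
  compared on the rays \<open>{x<..}\<close>, which determine them because the values are
  finite.\<close>

lemma nn_integral_coord_simplex:
  fixes g :: "real \<Rightarrow> ennreal"
  assumes [measurable]: "g \<in> borel_measurable borel"
  shows "(\<integral>\<^sup>+t. g (\<Sum>i\<in>UNIV. t $ i) * indicator (coord_simplex 1 :: (real^'n) set) t \<partial>lborel)
       = (\<integral>\<^sup>+r. g r * ennreal (r ^ (CARD('n) - 1) / fact (CARD('n) - 1)) * indicator {0..1} r \<partial>lborel)"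
proof -
  define d where "d = CARD('n)"
  have d: "d > 0" "real d * fact (d - 1) = fact d"
    by (auto simp: d_def fact_reduce[of "CARD('n)"])
  let ?D = "coord_simplex 1 :: (real^'n) set"
  define M where "M = distr (density lborel (indicator ?D)) borel (\<lambda>t. \<Sum>i\<in>UNIV. t $ i)"
  define N where "N = density lborel (\<lambda>r::real. ennreal (r ^ (d - 1) / fact (d - 1)) * indicator {0..1} r)"
  have M_eq: "emeasure M {x<..} = emeasure lborel {t\<in>?D. x < (\<Sum>i\<in>UNIV. t $ i)}" for x
  proof -
    have [measurable]: "(\<lambda>t::real^'n. \<Sum>i\<in>UNIV. t $ i) -` {x<..} \<in> sets borel"
      using measurable_sets[OF measurable_sum_vec, of "{x<..}"] by simp
    have "emeasure M {x<..} = emeasure (density lborel (indicator ?D)) ((\<lambda>t::real^'n. \<Sum>i\<in>UNIV. t $ i) -` {x<..})"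
      unfolding M_def by (subst emeasure_distr) simp_all
    also have "\<dots> = (\<integral>\<^sup>+t. indicator {t\<in>?D. x < (\<Sum>i\<in>UNIV. t $ i)} t \<partial>lborel)"
      by (subst emeasure_density) (auto simp: indicator_def intro!: nn_integral_cong simp del: nn_integral_indicator)
    also have "\<dots> = emeasure lborel {t\<in>?D. x < (\<Sum>i\<in>UNIV. t $ i)}"
      by (rule nn_integral_indicator) measurable
    finally show ?thesis .
  qed
  \<comment> \<open>Closing the interval at \<open>x\<close> changes it by at most one point and
    makes the fundamental theorem on closed intervals applicable.\<close>
  have N_eq: "emeasure N {x<..} = (\<integral>\<^sup>+r. ennreal (r ^ (d - 1) / fact (d - 1)) * indicator {max 0 x..1} r \<partial>lborel)" for x
    unfolding N_def
    by (subst emeasure_density, simp, simp, intro nn_integral_cong_AE, use AE_lborel_singleton[of x] in eventually_elim)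
      (auto simp: indicator_def)
  have fin: "emeasure lborel ?D = ennreal (1 / fact d)"
    by (simp add: emeasure_coord_simplex d_def)
  have M_val: "emeasure M {x<..} = ennreal ((1 - (max 0 (min 1 x)) ^ d) / fact d)" for x
  proof -
    \<comment> \<open>Clamping to [0, 1] lets one formula serve every real \<open>x\<close>.\<close>
    define y where "y = max 0 (min 1 x)"
    have y: "0 \<le> y" "y \<le> 1" by (auto simp: y_def)
    have "emeasure lborel {t\<in>?D. x < (\<Sum>i\<in>UNIV. t $ i)} = emeasure lborel (?D - coord_simplex y)"
    \<comment> \<open>For negative \<open>x\<close> nothing is removed from the simplex, whereas the
      right side removes the simplex of scale 0, which is null.\<close>
    proof (cases "x < 0")
      case True
      then have "y = 0" by (simp add: y_def)
      have "{t\<in>?D. x < (\<Sum>i\<in>UNIV. t $ i)} = ?D"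
        using True by (auto simp: coord_simplex_def intro!: less_le_trans[OF True] sum_nonneg)
      moreover have "emeasure lborel (?D - coord_simplex y) = emeasure lborel ?D"
      proof (rule emeasure_Diff_null_set)
        show "(coord_simplex y :: (real^'n) set) \<in> null_sets lborel"
          by (simp add: null_sets_def emeasure_coord_simplex \<open>y = 0\<close>)
      qed simp
      ultimately show ?thesis by simp
    next
      case False
      then have "{t\<in>?D. x < (\<Sum>i\<in>UNIV. t $ i)} = ?D - coord_simplex y"
        by (auto simp: coord_simplex_def y_def)
      then show ?thesis by simp
    qed
    also have "\<dots> = emeasure lborel ?D - emeasure lborel (coord_simplex y :: (real^'n) set)"
    proof (rule emeasure_Diff)
      show "(coord_simplex y :: (real^'n) set) \<subseteq> ?D"
        using y by (auto simp: coord_simplex_def)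
    qed (use y in \<open>auto simp: emeasure_coord_simplex\<close>)
    also have "\<dots> = ennreal ((1 - y ^ d) / fact d)"
      using y by (simp add: emeasure_coord_simplex d_def ennreal_minus diff_divide_distrib)
    finally show ?thesis by (simp add: M_eq y_def)
  qed
  have "M = N"
  proof (rule measure_eqI_lessThan)
    show "emeasure M {x<..} < \<infinity>" for x by (simp add: M_val)
    show "emeasure M {x<..} = emeasure N {x<..}" for x
    proof (cases "x \<le> 1")
      case True
      have "emeasure N {x<..} = ennreal (1 ^ d / fact d - (max 0 x) ^ d / fact d)"
        unfolding N_eq
      proof (rule nn_integral_FTC_Icc)
        fix r :: real
        show "((\<lambda>r. r ^ d / fact d) has_real_derivative r ^ (d - 1) / fact (d - 1)) (at r)"
          using d by (auto intro!: derivative_eq_intros simp: field_simps simp flip: d(2))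
      qed (use True in auto)
      then show ?thesis
        using True by (simp add: M_val min_absorb2 diff_divide_distrib)
    next
      case False
      then show ?thesis by (simp add: M_val N_eq)
    qed
  qed (simp_all add: M_def N_def)
  have "(\<integral>\<^sup>+t. g (\<Sum>i\<in>UNIV. t $ i) * indicator ?D t \<partial>lborel) = (\<integral>\<^sup>+r. g r \<partial>M)"
    by (simp add: M_def nn_integral_distr nn_integral_density mult.commute)
  also have "\<dots> = (\<integral>\<^sup>+r. g r * ennreal (r ^ (d - 1) / fact (d - 1)) * indicator {0..1} r \<partial>lborel)"
    unfolding \<open>M = N\<close> N_def by (simp add: nn_integral_density mult_ac)
  finally show ?thesis by (simp add: d_def)
qed

subsection \<open>Exponential moments\<close>

text \<open>The function F of the overview: the integral of e^(a r) over the standard simplex of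
  dimension \<open>m + 1\<close>, where r is the coordinate sum.\<close>

definition exp_moment :: "nat \<Rightarrow> real \<Rightarrow> real" where
  "exp_moment m a = integral {0..1} (\<lambda>r. exp (a * r) * (r ^ m / fact m))"

lemma has_integral_exp_moment:
  "((\<lambda>r. exp (a * r) * (r ^ m / fact m)) has_integral exp_moment m a) {0..1}"
  unfolding exp_moment_def
  by (intro integrable_integral integrable_continuous_real continuous_intros) auto

lemma continuous_on_exp_moment: "continuous_on UNIV (exp_moment m)"
  unfolding exp_moment_def [abs_def] box_real(2)[symmetric]
  by (rule integral_continuous_on_param) (auto intro!: continuous_intros simp: split_beta)

lemma exp_moment_nonneg: "0 \<le> exp_moment m a"
  by (rule has_integral_nonneg[OF has_integral_exp_moment]) auto

lemma deriv_power_div_fact: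
  "((\<lambda>x::real. x ^ Suc m / fact (Suc m)) has_real_derivative x ^ m / fact m) (at x within A)"
proof -
  have "((\<lambda>x::real. x ^ Suc m / fact (Suc m)) has_real_derivative
      real (Suc m) * x ^ m / (real (Suc m) * fact m)) (at x within A)"
    by (auto intro!: derivative_eq_intros simp del: power_Suc)
  then show ?thesis
    by (subst (asm) mult_divide_mult_cancel_left) auto
qed

text \<open>The substitution x = u r absorbs the power of \<open>u\<close> and leaves the integral
  of e^(-x) x^m / m! over [0, u], an incomplete gamma integral with an elementary
  antiderivative.\<close>

lemma exp_moment_minus:
  "u ^ Suc m * exp_moment m (- u) = 1 - exp (- u) * (\<Sum>i\<le>m. u ^ i / fact i)"
proof -
  have sum_deriv: "((\<lambda>x::real. \<Sum>i\<le>m. x ^ i / fact i) has_real_derivative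
      (\<Sum>i\<le>m. x ^ i / fact i) - x ^ m / fact m) (at x)" for x
  proof (induction m)
    case (Suc m)
    have "((\<lambda>x::real. x ^ Suc m / fact (Suc m)) has_real_derivative x ^ m / fact m) (at x)"
      by (rule deriv_power_div_fact)
    from DERIV_add[OF Suc this] show ?case by simp
  qed simp
  \<comment> \<open>Differentiating the truncated exponential series drops its top term, so in the
    derivative of this product only the top term survives.\<close>
  define P where "P x = - exp (- x) * (\<Sum>i\<le>m. x ^ i / fact i)" for x :: real
  have P_deriv: "(P has_real_derivative exp (- x) * (x ^ m / fact m)) (at x)" for x
    unfolding P_def by (rule derivative_eq_intros sum_deriv refl)+ (simp add: algebra_simps)
  have "((\<lambda>r. u ^ Suc m * (exp (- u * r) * (r ^ m / fact m))) has_integral P (u * 1) - P (u * 0)) {0..1}"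
  proof (rule fundamental_theorem_of_calculus)
    fix r :: real
    have "((\<lambda>r. P (u * r)) has_real_derivative exp (- (u * r)) * ((u * r) ^ m / fact m) * u) (at r within {0..1})"
      by (rule DERIV_chain'[where g=P, OF _ P_deriv]) (auto intro!: derivative_eq_intros)
    then show "((\<lambda>r. P (u * r)) has_vector_derivative u ^ Suc m * (exp (- u * r) * (r ^ m / fact m))) (at r within {0..1})"
      by (simp add: has_real_derivative_iff_has_vector_derivative power_mult_distrib mult_ac)
  qed simp
  moreover have "((\<lambda>r. u ^ Suc m * (exp (- u * r) * (r ^ m / fact m))) has_integral u ^ Suc m * exp_moment m (- u)) {0..1}"
    by (rule has_integral_mult_right[OF has_integral_exp_moment])
  ultimately have "u ^ Suc m * exp_moment m (- u) = P u - P 0"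
    by (simp add: has_integral_unique)
  \<comment> \<open>Only the term i = 0 remains, with 0^0 = 1.\<close>
  moreover have "P 0 = - 1"
    by (simp add: P_def power_0_left if_distrib[where f="\<lambda>x. x / _"] sum.delta cong: if_cong)
  ultimately show ?thesis by (simp add: P_def)
qed

lemma exp_moment_minus_le: "0 \<le> u \<Longrightarrow> u ^ Suc m * exp_moment m (- u) \<le> 1"
  unfolding exp_moment_minus by (simp add: sum_nonneg)

lemma exp_moment_minus_tendsto:
  "((\<lambda>u. u ^ Suc m * exp_moment m (- u)) \<longlongrightarrow> 1) at_top"
proof -
  have "((\<lambda>u::real. u ^ i / exp u / fact i) \<longlongrightarrow> 0) at_top" for i
    using tendsto_divide[OF tendsto_power_div_exp_0[of i] tendsto_const[of "fact i"]] by simp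
  then have "((\<lambda>u::real. 1 - (\<Sum>i\<le>m. u ^ i / exp u / fact i)) \<longlongrightarrow> 1 - (\<Sum>i\<le>m. 0)) at_top"
    by (intro tendsto_diff tendsto_sum tendsto_const) auto
  then show ?thesis
    unfolding exp_moment_minus by (simp add: exp_minus sum_distrib_left field_simps)
qed

lemma has_integral_exp_linear:
  assumes "a \<noteq> 0"
  shows "((\<lambda>r. exp (a * r)) has_integral (exp a - 1) / a) {0..1::real}"
proof -
  have "((\<lambda>r. exp (a * r)) has_integral exp (a * 1) / a - exp (a * 0) / a) {0..1}"
    by (rule fundamental_theorem_of_calculus)
      (use assms in \<open>auto intro!: derivative_eq_intros simp flip: has_real_derivative_iff_has_vector_derivative\<close>)
  then show ?thesis by (simp add: diff_divide_distrib)
qed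

text \<open>The weight r^m / m! is at most 1 on the unit interval, so the integral of the bare
  exponential is an upper bound.\<close>

lemma exp_moment_le:
  assumes "0 < a"
  shows "a * exp_moment m a \<le> exp a"
proof -
  have "exp_moment m a \<le> (exp a - 1) / a"
  proof (rule has_integral_le[OF has_integral_exp_moment has_integral_exp_linear])
    fix r :: real assume "r \<in> {0..1}"
    then have "r ^ m / fact m \<le> 1"
      by (auto intro: order_trans[OF power_le_one fact_ge_1])
    then show "exp (a * r) * (r ^ m / fact m) \<le> exp (a * r)"
      by (intro mult_left_le) auto
  qed (use assms in auto)
  then show ?thesis using assms by (simp add: field_simps)
qed

text \<open>Integration by parts, carried out as the fundamental theorem for e^(a r) r^(m+1) /
  (m+1)!, whose boundary value at 0 vanishes.\<close>

lemma exp_moment_Suc: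
  "a * exp_moment (Suc m) a = exp a / fact (Suc m) - exp_moment m a"
proof -
  have "((\<lambda>r. a * (exp (a * r) * (r ^ Suc m / fact (Suc m))) + exp (a * r) * (r ^ m / fact m))
      has_integral exp (a * 1) * (1 ^ Suc m / fact (Suc m)) - exp (a * 0) * (0 ^ Suc m / fact (Suc m))) {0..1}"
  proof (rule fundamental_theorem_of_calculus)
    fix r :: real
    have "((\<lambda>r. exp (a * r)) has_real_derivative a * exp (a * r)) (at r within {0..1})"
      by (auto intro!: derivative_eq_intros)
    from DERIV_mult[OF this deriv_power_div_fact]
    show "((\<lambda>r. exp (a * r) * (r ^ Suc m / fact (Suc m))) has_vector_derivative
        a * (exp (a * r) * (r ^ Suc m / fact (Suc m))) + exp (a * r) * (r ^ m / fact m)) (at r within {0..1})"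
      unfolding has_real_derivative_iff_has_vector_derivative[symmetric]
      by (simp add: mult_ac)
  qed simp
  moreover have "((\<lambda>r. a * (exp (a * r) * (r ^ Suc m / fact (Suc m))) + exp (a * r) * (r ^ m / fact m))
      has_integral a * exp_moment (Suc m) a + exp_moment m a) {0..1}"
    by (intro has_integral_add has_integral_mult_right has_integral_exp_moment)
  ultimately have "a * exp_moment (Suc m) a + exp_moment m a
      = exp (a * 1) * (1 ^ Suc m / fact (Suc m)) - exp (a * 0) * (0 ^ Suc m / fact (Suc m))"
    by (rule has_integral_unique[symmetric])
  then show ?thesis by simp
qed

text \<open>For large \<open>u\<close> the mass concentrates at r = 1, where the weight is 1 / m!.
  Formally, the recursion leaves the preceding moment divided by e^u as error, which is at most 1 /
  u; the case m = 0 is explicit.\<close>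

lemma exp_moment_tendsto:
  "((\<lambda>u. u * exp_moment m u / exp u) \<longlongrightarrow> 1 / fact m) at_top"
proof (cases m)
  case 0
  have "((\<lambda>u::real. (exp u - 1) / exp u) \<longlongrightarrow> 1) at_top"
    by real_asymp
  moreover have "eventually (\<lambda>u. u * exp_moment m u / exp u = (exp u - 1) / exp u) at_top"
    using eventually_gt_at_top[of "0::real"]
  proof eventually_elim
    case (elim u)
    have "exp_moment m u = (exp u - 1) / u"
      using has_integral_unique[OF has_integral_exp_moment[of u m]] has_integral_exp_linear[of u] elim 0
      by simp
    with elim show ?case by simp
  qed
  ultimately have "((\<lambda>u. u * exp_moment m u / exp u) \<longlongrightarrow> 1) at_top"
    by (subst tendsto_cong)
  with 0 show ?thesis by simp
next
  case (Suc k)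
  have "((\<lambda>u. exp_moment k u / exp u) \<longlongrightarrow> 0) at_top"
  proof (rule tendsto_sandwich[of "\<lambda>_. 0" _ _ "\<lambda>u. 1 / u"])
    show "eventually (\<lambda>u. exp_moment k u / exp u \<le> 1 / u) at_top"
      using eventually_gt_at_top[of "0::real"]
      by eventually_elim (use exp_moment_le in \<open>auto simp: field_simps\<close>)
    show "((\<lambda>u::real. 1 / u) \<longlongrightarrow> 0) at_top"
      by real_asymp
  qed (auto simp: exp_moment_nonneg)
  then have "((\<lambda>u. 1 / fact m - exp_moment k u / exp u) \<longlongrightarrow> 1 / fact m - 0) at_top"
    by (intro tendsto_intros)
  moreover have "u * exp_moment m u / exp u = 1 / fact m - exp_moment k u / exp u" for u
    unfolding Suc exp_moment_Suc by (simp add: diff_divide_distrib)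
  ultimately show ?thesis by simp
qed

subsection \<open>Slabs over a cone\<close>

lemma nn_integral_lborel_affine:
  fixes f :: "'a::euclidean_space \<Rightarrow> ennreal"
  assumes [measurable]: "f \<in> borel_measurable borel" and "a \<noteq> 0"
  shows "(\<integral>\<^sup>+x. f x \<partial>lborel) = ennreal (\<bar>a\<bar> ^ DIM('a)) * (\<integral>\<^sup>+t. f (b + a *\<^sub>R t) \<partial>lborel)"
  by (subst lborel_affine[OF \<open>a \<noteq> 0\<close>, of b])
    (simp add: nn_integral_density nn_integral_distr nn_integral_cmult)

text \<open>The \<open>t\<close> with \<open>x = z (v + c t)\<close>, provided that \<open>z\<close> and \<open>c\<close> are nonzero.\<close>
definition simplex_coords :: "real^'n \<Rightarrow> real \<Rightarrow> real^'n \<Rightarrow> real \<Rightarrow> real^'n" where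
  "simplex_coords v c x z = (1 / c) *\<^sub>R ((1 / z) *\<^sub>R x - v)"

text \<open>The bounds see a point only through the coordinate sum and the height \<open>z\<close>,
  which is what permits the reduction to two variables. Requiring z > 0 keeps
  \<open>simplex_coords\<close> meaningful; the slice z = 0 is treated separately as a null
  set.\<close>

definition cone_slab ::
  "real^'n \<Rightarrow> real \<Rightarrow> (real \<Rightarrow> real \<Rightarrow> real) \<Rightarrow> (real \<Rightarrow> real \<Rightarrow> real) \<Rightarrow> ((real^'n) \<times> real \<times> real) set" where
  "cone_slab v c lo hi = {(x, y, z). 0 < z \<and> z \<le> 1 \<and> simplex_coords v c x z \<in> coord_simplex 1
     \<and> lo (\<Sum>i\<in>UNIV. simplex_coords v c x z $ i) z \<le> y
     \<and> y \<le> hi (\<Sum>i\<in>UNIV. simplex_coords v c x z $ i) z}"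

context
  fixes v :: "real^'n" and c :: real and lo hi :: "real \<Rightarrow> real \<Rightarrow> real"
  assumes c: "c \<noteq> 0"
    and lo [measurable]: "case_prod lo \<in> borel_measurable (borel \<Otimes>\<^sub>M borel)"
    and hi [measurable]: "case_prod hi \<in> borel_measurable (borel \<Otimes>\<^sub>M borel)"
begin

lemma measurable_simplex_coords [measurable]:
  "(\<lambda>(x, z). simplex_coords v c x z) \<in> borel_measurable (borel \<Otimes>\<^sub>M borel)"
  unfolding simplex_coords_def by measurable

lemma measurable_cone_slab [measurable]: "cone_slab v c lo hi \<in> sets (borel \<Otimes>\<^sub>M borel \<Otimes>\<^sub>M borel)"
proof -
  let ?M = "borel \<Otimes>\<^sub>M borel \<Otimes>\<^sub>M borel :: ((real^'n) \<times> real \<times> real) measure"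
  define T where "T p = simplex_coords v c (fst p) (snd (snd p))" for p :: "(real^'n) \<times> real \<times> real"
  have T [measurable]: "T \<in> ?M \<rightarrow>\<^sub>M borel"
    unfolding T_def simplex_coords_def by measurable
  define R where "R p = (\<Sum>i\<in>UNIV. T p $ i)" for p
  have [measurable]: "R \<in> ?M \<rightarrow>\<^sub>M borel"
    unfolding R_def by (rule measurable_compose[OF T measurable_sum_vec])
  have "cone_slab v c lo hi = {p \<in> space ?M. 0 < snd (snd p) \<and> snd (snd p) \<le> 1 \<and> T p \<in> coord_simplex 1
      \<and> lo (R p) (snd (snd p)) \<le> fst (snd p) \<and> fst (snd p) \<le> hi (R p) (snd (snd p))}"
    by (auto simp: cone_slab_def T_def R_def space_pair_measure)
  also have "\<dots> \<in> sets ?M"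
    by measurable
  finally show ?thesis .
qed

lemma borel_cone_slab: "cone_slab v c lo hi \<in> sets borel"
  using measurable_cone_slab unfolding borel_prod .

text \<open>Tonelli with \<open>y\<close> innermost: \<open>y\<close> contributes the gap between
  the bounds, the affine change of variables in \<open>x\<close> contributes the Jacobian (|c| z)^d,
  and the coordinate sum is integrated by \<open>nn_integral_coord_simplex\<close>.\<close>

lemma emeasure_cone_slab:
  "emeasure lborel (cone_slab v c lo hi) =
     (\<integral>\<^sup>+z. ennreal ((\<bar>c\<bar> * z) ^ CARD('n)) *
       (\<integral>\<^sup>+r. ennreal (hi r z - lo r z) * ennreal (r ^ (CARD('n) - 1) / fact (CARD('n) - 1)) * indicator {0..1} r \<partial>lborel)
       * indicator {0<..1} z \<partial>lborel)"
proof -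
  define I :: "(real^'n) \<times> real \<times> real \<Rightarrow> ennreal" where "I = indicator (cone_slab v c lo hi)"
  \<comment> \<open>A negative difference is sent to 0 by \<open>ennreal\<close>, in agreement with
    an empty interval for \<open>y\<close>.\<close>
  define G where "G z t = ennreal (hi (\<Sum>i\<in>UNIV. t $ i) z - lo (\<Sum>i\<in>UNIV. t $ i) z) * indicator (coord_simplex 1) t"
    for z and t :: "real^'n"
  have [measurable]: "I \<in> borel_measurable (borel \<Otimes>\<^sub>M borel \<Otimes>\<^sub>M borel)"
    unfolding I_def by measurable
  have [measurable]: "G z \<in> borel_measurable borel" for z
    unfolding G_def by measurable
  have Iy: "(\<integral>\<^sup>+y. I (x, y, z) \<partial>lborel) = G z (simplex_coords v c x z) * indicator {0<..1} z" for x z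
  proof -
    let ?r = "\<Sum>i\<in>UNIV. simplex_coords v c x z $ i"
    have "(\<integral>\<^sup>+y. I (x, y, z) \<partial>lborel) = (\<integral>\<^sup>+y. indicator {lo ?r z..hi ?r z} y
        * (indicator (coord_simplex 1) (simplex_coords v c x z) * indicator {0<..1} z) \<partial>lborel)"
      by (intro nn_integral_cong) (auto simp: I_def cone_slab_def indicator_def)
    also have "\<dots> = ennreal (hi ?r z - lo ?r z) *
        (indicator (coord_simplex 1) (simplex_coords v c x z) * indicator {0<..1} z)"
      by (subst nn_integral_multc) (auto simp: emeasure_lborel_Icc_eq ennreal_neg)
    finally show ?thesis by (simp add: G_def mult.assoc)
  qed
  have Ix: "(\<integral>\<^sup>+x. G z (simplex_coords v c x z) \<partial>lborel) = ennreal ((\<bar>c\<bar> * z) ^ CARD('n)) *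
      (\<integral>\<^sup>+r. ennreal (hi r z - lo r z) * ennreal (r ^ (CARD('n) - 1) / fact (CARD('n) - 1)) * indicator {0..1} r \<partial>lborel)"
    if z: "0 < z" for z
  proof -
    have coords: "simplex_coords v c (z *\<^sub>R v + (z * c) *\<^sub>R t) z = t" for t
      using c z by (simp add: simplex_coords_def scaleR_add_right)
    have "(\<integral>\<^sup>+x. G z (simplex_coords v c x z) \<partial>lborel)
        = ennreal (\<bar>z * c\<bar> ^ DIM(real^'n)) * (\<integral>\<^sup>+t. G z t \<partial>lborel)"
      using c z by (subst nn_integral_lborel_affine[where a="z * c" and b="z *\<^sub>R v"]) (auto simp: coords)
    also have "(\<integral>\<^sup>+t. G z t \<partial>lborel) =
      (\<integral>\<^sup>+r. ennreal (hi r z - lo r z) * ennreal (r ^ (CARD('n) - 1) / fact (CARD('n) - 1)) * indicator {0..1} r \<partial>lborel)"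
      unfolding G_def by (rule nn_integral_coord_simplex) measurable
    finally show ?thesis using z by (simp add: abs_mult mult.commute)
  qed
  have "emeasure lborel (cone_slab v c lo hi) = (\<integral>\<^sup>+p. I p \<partial>(lborel \<Otimes>\<^sub>M (lborel \<Otimes>\<^sub>M lborel)))"
    unfolding I_def lborel_prod
    by (rule nn_integral_indicator[symmetric]) (simp add: borel_cone_slab)
  also have "\<dots> = (\<integral>\<^sup>+q. (\<integral>\<^sup>+x. I (x, q) \<partial>lborel) \<partial>(lborel \<Otimes>\<^sub>M lborel))"
  proof -
    interpret P: pair_sigma_finite "lborel :: (real^'n) measure" "lborel \<Otimes>\<^sub>M lborel :: (real \<times> real) measure"
      unfolding lborel_prod by (rule lborel_pair.pair_sigma_finite_axioms)
    show ?thesis by (rule P.nn_integral_snd[symmetric]) measurable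
  qed
  also have "\<dots> = (\<integral>\<^sup>+z. (\<integral>\<^sup>+y. (\<integral>\<^sup>+x. I (x, y, z) \<partial>lborel) \<partial>lborel) \<partial>lborel)"
    by (rule lborel_pair.nn_integral_snd[symmetric]) measurable
  \<comment> \<open>The swap puts \<open>y\<close> inside, where it ranges over an interval with
    ends determined by \<open>x\<close> and \<open>z\<close>.\<close>
  also have "\<dots> = (\<integral>\<^sup>+z. (\<integral>\<^sup>+x. (\<integral>\<^sup>+y. I (x, y, z) \<partial>lborel) \<partial>lborel) \<partial>lborel)"
    by (intro nn_integral_cong lborel_pair.Fubini') measurable
  also have "\<dots> = (\<integral>\<^sup>+z. (\<integral>\<^sup>+x. G z (simplex_coords v c x z) * indicator {0<..1} z \<partial>lborel) \<partial>lborel)"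
    unfolding Iy ..
  also have "\<dots> = (\<integral>\<^sup>+z. (\<integral>\<^sup>+x. G z (simplex_coords v c x z) \<partial>lborel) * indicator {0<..1} z \<partial>lborel)"
    by (intro nn_integral_cong nn_integral_multc) measurable
  also have "\<dots> = (\<integral>\<^sup>+z. ennreal ((\<bar>c\<bar> * z) ^ CARD('n)) *
       (\<integral>\<^sup>+r. ennreal (hi r z - lo r z) * ennreal (r ^ (CARD('n) - 1) / fact (CARD('n) - 1)) * indicator {0..1} r \<partial>lborel)
       * indicator {0<..1} z \<partial>lborel)"
    by (intro nn_integral_cong) (auto simp: indicator_def Ix)
  finally show ?thesis .
qed

end

subsection \<open>The two relaxations as slabs\<close>

text \<open>The three heights are the bounds on \<open>y\<close> at x = z (v + c t), where
  \<open>s\<close> is the coordinate sum of \<open>v\<close> and \<open>r\<close> that of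
  \<open>t\<close>. This one is \<open>z\<close> times the chord of e^(s + c r) - 1 through r = 0
  and r = 1.\<close>

definition upper_height :: "real \<Rightarrow> real \<Rightarrow> real \<Rightarrow> real \<Rightarrow> real" where
  "upper_height s c r z = z * (exp s * (1 + (exp c - 1) * r) - 1)"

definition naive_height :: "real \<Rightarrow> real \<Rightarrow> real \<Rightarrow> real \<Rightarrow> real" where
  "naive_height s c r z = exp (z * (s + c * r)) - 1"

definition persp_height :: "real \<Rightarrow> real \<Rightarrow> real \<Rightarrow> real \<Rightarrow> real" where
  "persp_height s c r z = z * (exp (s + c * r) - 1)"

lemma measurable_heights [measurable]:
  "case_prod (upper_height s c) \<in> borel_measurable (borel \<Otimes>\<^sub>M borel)"
  "case_prod (naive_height s c) \<in> borel_measurable (borel \<Otimes>\<^sub>M borel)"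
  "case_prod (persp_height s c) \<in> borel_measurable (borel \<Otimes>\<^sub>M borel)"
  unfolding upper_height_def naive_height_def persp_height_def by measurable

text \<open>Convexity of exp on the segment from 0 to s + c r with weight \<open>z\<close>; the
  shift by 1 makes the value at 0 vanish.\<close>

lemma naive_height_le_persp_height:
  assumes "0 \<le> z" "z \<le> 1"
  shows "naive_height s c r z \<le> persp_height s c r z"
  using convex_onD[OF exp_convex, of z 0 "s + c * r"] assms
  by (simp add: naive_height_def persp_height_def algebra_simps)

text \<open>On [0, 1] a convex function lies below its chord.\<close>

lemma persp_height_le_upper_height:
  assumes "0 \<le> r" "r \<le> 1" "0 \<le> z"
  shows "persp_height s c r z \<le> upper_height s c r z"
proof -
  have "exp (s + c * r) \<le> exp s * (1 + (exp c - 1) * r)"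
    using convex_onD[OF exp_convex, of r 0 c] assms
    unfolding exp_add by (intro mult_left_mono) (auto simp: algebra_simps)
  then show ?thesis
    using assms by (simp add: upper_height_def persp_height_def mult_left_mono)
qed

text \<open>The signs c = -u and c = u give the vertex sets of the two families.\<close>

abbreviation (input) corner_vertices :: "real^'n \<Rightarrow> real \<Rightarrow> (real^'n) set" where
  "corner_vertices v c \<equiv> insert v (range (\<lambda>j. v + c *\<^sub>R axis j 1))"

context
  fixes v :: "real^'n" and c :: real
  assumes c: "c \<noteq> 0"
begin

private abbreviation (input) "V \<equiv> corner_vertices v c"
private abbreviation (input) "s \<equiv> \<Sum>i\<in>UNIV. v $ i"

lemma convex_hull_corner: "convex hull V = (\<lambda>t. v + c *\<^sub>R t) ` coord_simplex 1"
proof -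
  have "V = (\<lambda>t. v + c *\<^sub>R t) ` insert 0 (range (\<lambda>j. axis j 1))"
    by auto
  then show ?thesis
    by (metis convex_hull_affinity convex_hull_coord_simplex)
qed

lemma mem_scaled_hull_corner:
  assumes "0 < z"
  shows "x \<in> (\<lambda>w. z *\<^sub>R w) ` (convex hull V) \<longleftrightarrow> simplex_coords v c x z \<in> coord_simplex 1"
proof -
  have "x = z *\<^sub>R (v + c *\<^sub>R t) \<longleftrightarrow> simplex_coords v c x z = t" for t
    using c assms by (auto simp: simplex_coords_def scaleR_add_right scaleR_diff_right)
  then show ?thesis
    by (simp add: convex_hull_corner image_image image_iff del: convex_hull_insert)
qed

text \<open>Since \<open>expf\<close> takes one common value at all vertices other than
  \<open>v\<close>, an interpolant with equal slopes in all coordinates works. Uniqueness holds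
  because the edges at \<open>v\<close> are nonzero multiples of the unit vectors.\<close>

lemma affine_interp_corner:
  "affine_interp expf V = (\<lambda>x. exp s * (exp c - 1) / c * ((\<Sum>i\<in>UNIV. x $ i) - s) + (exp s - 1))"
    (is "_ = ?g")
  unfolding affine_interp_def
proof (rule the_equality)
  let ?k = "exp s * (exp c - 1) / c"
  have g: "?g = (\<lambda>x. (\<chi> i. ?k) \<bullet> x + (exp s - 1 - ?k * s))"
    by (simp add: inner_vec_def fun_eq_iff right_diff_distrib sum_distrib_left)
  have sum_axis: "(\<Sum>i\<in>UNIV. (v + c *\<^sub>R axis j 1) $ i) = s + c" for j
    by (simp add: sum.distrib axis_def sum_distrib_left[symmetric])
  have g_V: "\<forall>w\<in>V. ?g w = expf w"
    using c by (auto simp: expf_def sum_axis exp_add field_simps simp del: vector_add_component)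
  show "(\<exists>a b. ?g = (\<lambda>x. a \<bullet> x + b)) \<and> (\<forall>w\<in>V. ?g w = expf w)"
    using g g_V by blast
  fix h :: "real^'n \<Rightarrow> real"
  assume h: "(\<exists>a b. h = (\<lambda>x. a \<bullet> x + b)) \<and> (\<forall>w\<in>V. h w = expf w)"
  then obtain a b where ab: "h = (\<lambda>x. a \<bullet> x + b)" by blast
  have agree: "a \<bullet> w + b = (\<chi> i. ?k) \<bullet> w + (exp s - 1 - ?k * s)" if "w \<in> V" for w
  proof -
    have "a \<bullet> w + b = ?g w"
      using h g_V that unfolding ab by metis
    then show ?thesis by (simp only: fun_cong[OF g])
  qed
  \<comment> \<open>Subtracting the agreement at \<open>v\<close> from that at the vertex in
    direction \<open>j\<close> isolates the j-th slope; agreement at \<open>v\<close> then fixes the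
    constant.\<close>
  have "a = (\<chi> i. ?k)"
  proof (rule vec_eq_iff[THEN iffD2], rule allI)
    fix j
    have "a \<bullet> (c *\<^sub>R axis j 1) = (\<chi> i. ?k) \<bullet> (c *\<^sub>R axis j 1)"
      using agree[OF insertI1] agree[OF insertI2[OF rangeI[of _ j]]] unfolding inner_add_right by linarith
    with c have "a \<bullet> axis j 1 = (\<chi> i. ?k) \<bullet> axis j 1"
      by (simp only: inner_scaleR_right mult_cancel_left) simp
    then show "a $ j = (\<chi> i. ?k) $ j"
      by (simp add: inner_axis)
  qed
  with agree[of v] show "h = ?g"
    unfolding ab g by simp
qed

lemma sum_simplex_coords:
  assumes "0 < z"
  shows "(\<Sum>i\<in>UNIV. x $ i) = z * (s + c * (\<Sum>i\<in>UNIV. simplex_coords v c x z $ i))"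
proof -
  have "c * (\<Sum>i\<in>UNIV. simplex_coords v c x z $ i) = (\<Sum>i\<in>UNIV. x $ i) / z - s"
    using c by (simp add: simplex_coords_def sum_subtractf flip: sum_divide_distrib)
  with assms show ?thesis by simp
qed

lemma persp_mu_corner:
  assumes "0 < z"
  shows "persp_mu expf V x z = upper_height s c (\<Sum>i\<in>UNIV. simplex_coords v c x z $ i) z"
  unfolding persp_mu_def affine_interp_corner sum_simplex_coords[OF assms, of x] upper_height_def
  using c by (simp add: field_simps)

text \<open>At z = 0 the scaled simplex is the origin, and there both bounds on \<open>y\<close> are
  0, so this slice is a single point.\<close>

lemma naive_relax_corner:
  "naive_relax expf V = insert (0, 0, 0) (cone_slab v c (naive_height s c) (upper_height s c))"
proof (rule set_eqI, clarify)
  fix x :: "real^'n" and y z :: real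
  consider "z < 0" | "z = 0" | "0 < z" by linarith
  then show "(x, y, z) \<in> naive_relax expf V \<longleftrightarrow>
      (x, y, z) \<in> insert (0, 0, 0) (cone_slab v c (naive_height s c) (upper_height s c))"
  proof cases
    case 2
    have "convex hull V \<noteq> {}" by simp
    then have "(\<lambda>w. z *\<^sub>R w) ` (convex hull V) = {0}"
      using 2 by (simp add: image_constant_conv)
    with 2 show ?thesis
      by (auto simp: naive_relax_def cone_slab_def persp_mu_def expf_def)
  next
    case 3
    then show ?thesis
      unfolding naive_relax_def cone_slab_def
      by (simp add: mem_scaled_hull_corner persp_mu_corner expf_def naive_height_def sum_simplex_coords[OF 3, of x]) blast
  qed (auto simp: naive_relax_def cone_slab_def)
qed

lemma persp_relax_corner:
  "persp_relax expf V = closure (cone_slab v c (persp_height s c) (upper_height s c))"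
proof -
  have "{(x, y, z). persp_mu expf V x z \<ge> y \<and> y \<ge> z * expf ((1 / z) *\<^sub>R x)
      \<and> x \<in> (\<lambda>w. z *\<^sub>R w) ` (convex hull V) \<and> z \<le> 1 \<and> 0 < z}
    = cone_slab v c (persp_height s c) (upper_height s c)"
  proof (rule set_eqI, clarify)
    fix x :: "real^'n" and y z :: real
    have "expf ((1 / z) *\<^sub>R x) = exp (s + c * (\<Sum>i\<in>UNIV. simplex_coords v c x z $ i)) - 1" if "0 < z"
      using that sum_simplex_coords[OF that, of x] by (simp add: expf_def flip: sum_divide_distrib)
    then show "(x, y, z) \<in> {(x, y, z). persp_mu expf V x z \<ge> y \<and> y \<ge> z * expf ((1 / z) *\<^sub>R x)
        \<and> x \<in> (\<lambda>w. z *\<^sub>R w) ` (convex hull V) \<and> z \<le> 1 \<and> 0 < z}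
      \<longleftrightarrow> (x, y, z) \<in> cone_slab v c (persp_height s c) (upper_height s c)"
      unfolding cone_slab_def
      by (cases "0 < z") (auto simp: mem_scaled_hull_corner persp_mu_corner persp_height_def)
  qed
  then show ?thesis unfolding persp_relax_def by simp
qed

end

text \<open>Away from z = 0 the simplex coordinates are continuous, so all non-strict constraints
  pass to limits. The only strict one, 0 < z, can fail in the limit only through z = 0.\<close>

lemma closure_cone_slab_subset:
  fixes v :: "real^'n"
  assumes lo: "continuous_on UNIV (case_prod lo)" and hi: "continuous_on UNIV (case_prod hi)"
  shows "closure (cone_slab v c lo hi) \<subseteq> cone_slab v c lo hi \<union> {(x, y, z). z = 0}"
proof -
  have "(x, y, z) \<in> cone_slab v c lo hi \<union> {(x, y, z). z = 0}"
    if q: "(x, y, z) \<in> closure (cone_slab v c lo hi)" for x :: "real^'n" and y z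
  proof (cases "z = 0")
    case z0: False
    from q obtain p where p: "\<And>n. p n \<in> cone_slab v c lo hi" and lim: "p \<longlonglongrightarrow> (x, y, z)"
      unfolding closure_sequential by blast
    define X Y Z where "X n = fst (p n)" and "Y n = fst (snd (p n))" and "Z n = snd (snd (p n))" for n
    have XYZ: "X \<longlonglongrightarrow> x" "Y \<longlonglongrightarrow> y" "Z \<longlonglongrightarrow> z"
      using tendsto_fst[OF lim] tendsto_fst[OF tendsto_snd[OF lim]] tendsto_snd[OF tendsto_snd[OF lim]]
      by (simp_all add: X_def[abs_def] Y_def[abs_def] Z_def[abs_def])
    let ?r = "\<lambda>x z. \<Sum>i\<in>UNIV. simplex_coords v c x z $ i"
    have mem: "0 < Z n" "Z n \<le> 1" "simplex_coords v c (X n) (Z n) \<in> coord_simplex 1"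
        "lo (?r (X n) (Z n)) (Z n) \<le> Y n" "Y n \<le> hi (?r (X n) (Z n)) (Z n)" for n
      using p[of n] by (auto simp: cone_slab_def X_def Y_def Z_def split_beta)
    have T: "(\<lambda>n. simplex_coords v c (X n) (Z n)) \<longlonglongrightarrow> simplex_coords v c x z"
      unfolding simplex_coords_def by (intro tendsto_intros XYZ z0)
    then have rz: "(\<lambda>n. (?r (X n) (Z n), Z n)) \<longlonglongrightarrow> (?r x z, z)"
      by (intro tendsto_intros XYZ)
    have "0 \<le> z"
      using LIMSEQ_le_const[OF XYZ(3)] mem(1) by (meson less_imp_le)
    moreover have "z \<le> 1"
      using LIMSEQ_le_const2[OF XYZ(3)] mem(2) by blast
    moreover have "simplex_coords v c x z \<in> coord_simplex 1"
      using closed_sequentially[OF closed_coord_simplex _ T] mem by blast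
    moreover have "lo (?r x z) z \<le> y"
      using LIMSEQ_le[OF continuous_on_tendsto_compose[OF lo rz] XYZ(2)] mem by auto
    moreover have "y \<le> hi (?r x z) z"
      using LIMSEQ_le[OF XYZ(2) continuous_on_tendsto_compose[OF hi rz]] mem by auto
    ultimately show ?thesis
      using z0 by (simp add: cone_slab_def)
  qed simp
  then show ?thesis by auto
qed

lemma null_sets_third_eq_zero:
  "{(x, y, z). z = 0} \<in> null_sets (lborel :: ((real^'n) \<times> real \<times> real) measure)"
proof -
  have eq: "{(x, y, z). z = 0} = {p :: (real^'n) \<times> real \<times> real. (0, 0, 1) \<bullet> p = 0}"
    by (auto simp: inner_prod_def)
  have "negligible {p :: (real^'n) \<times> real \<times> real. (0, 0, 1) \<bullet> p = 0}"
    by (rule negligible_hyperplane) (simp add: zero_prod_def)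
  moreover have "{p :: (real^'n) \<times> real \<times> real. (0, 0, 1) \<bullet> p = 0} \<in> sets borel"
    by (intro borel_closed closed_hyperplane)
  ultimately show ?thesis
    unfolding eq by (simp add: negligible_iff_null_sets null_sets_completion_iff)
qed

subsection \<open>Volumes\<close>

lemma continuous_on_heights:
  "continuous_on UNIV (case_prod (upper_height s c))"
  "continuous_on UNIV (case_prod (persp_height s c))"
  unfolding upper_height_def persp_height_def split_beta
  by (intro continuous_intros)+

lemma measure_naive_relax:
  fixes v :: "real^'n"
  assumes "c \<noteq> 0"
  defines "s \<equiv> \<Sum>i\<in>UNIV. v $ i"
  shows "measure lborel (naive_relax expf (corner_vertices v c))
       = measure lborel (cone_slab v c (naive_height s c) (upper_height s c))"
proof -
  have [simp]: "cone_slab v c (naive_height s c) (upper_height s c) \<in> sets borel"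
    by (rule borel_cone_slab[OF assms(1)]) measurable
  have "{(0, 0, 0)} \<in> sets (borel :: ((real^'n) \<times> real \<times> real) measure)"
    by simp
  then show ?thesis
    unfolding naive_relax_corner[OF assms(1)] s_def[symmetric]
    using AE_lborel_singleton[of "(0, 0, 0)"]
    by (intro measure_eq_AE) (auto elim!: eventually_mono intro: sets.insert_in_sets)
qed

lemma measure_persp_relax:
  fixes v :: "real^'n"
  assumes "c \<noteq> 0"
  defines "s \<equiv> \<Sum>i\<in>UNIV. v $ i"
  shows "measure lborel (persp_relax expf (corner_vertices v c))
       = measure lborel (cone_slab v c (persp_height s c) (upper_height s c))"
proof -
  let ?A = "cone_slab v c (persp_height s c) (upper_height s c)"
  have [simp]: "?A \<in> sets borel"
    by (rule borel_cone_slab[OF assms(1)]) measurable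
  have "AE p in lborel. p \<notin> {(x :: real^'n, y :: real, z :: real). z = 0}"
    using null_sets_third_eq_zero by (rule AE_not_in)
  then have "AE p in lborel. p \<in> closure ?A \<longleftrightarrow> p \<in> ?A"
    by (rule eventually_mono)
      (use closure_cone_slab_subset[OF continuous_on_heights(2,1), of v c s c s c] closure_subset[of ?A] in blast)
  then show ?thesis
    unfolding persp_relax_corner[OF assms(1)] s_def[symmetric]
    by (rule measure_eq_AE) simp_all
qed

text \<open>Turns the nested nonnegative integrals into real ones: \<open>w\<close> is the integral
  over the coordinate sum at height \<open>z\<close>, \<open>J\<close> the one over \<open>z\<close>
  with its share of the Jacobian. The order of the bounds ensures that \<open>ennreal\<close>
  truncates nothing.\<close>

lemma measure_cone_slab:
  fixes v :: "real^'n"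
  assumes "c \<noteq> 0"
    and [measurable]: "case_prod lo \<in> borel_measurable (borel \<Otimes>\<^sub>M borel)"
      "case_prod hi \<in> borel_measurable (borel \<Otimes>\<^sub>M borel)"
    and le: "\<And>r z. r \<in> {0..1} \<Longrightarrow> z \<in> {0..1} \<Longrightarrow> lo r z \<le> hi r z"
    and inner: "\<And>z. z \<in> {0..1} \<Longrightarrow>
      ((\<lambda>r. (hi r z - lo r z) * (r ^ (CARD('n) - 1) / fact (CARD('n) - 1))) has_integral w z) {0..1}"
    and outer: "((\<lambda>z. z ^ CARD('n) * w z) has_integral J) {0..1}"
  shows "measure lborel (cone_slab v c lo hi) = \<bar>c\<bar> ^ CARD('n) * J"
proof -
  let ?d = "CARD('n)"
  have w: "0 \<le> w z" if "z \<in> {0..1}" for z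
    using inner[OF that] by (rule has_integral_nonneg) (use le that in auto)
  have J: "0 \<le> J"
    using outer by (rule has_integral_nonneg) (use w in auto)
  have "emeasure lborel (cone_slab v c lo hi) =
      (\<integral>\<^sup>+z. ennreal (\<bar>c\<bar> ^ ?d * (z ^ ?d * w z)) * indicator {0..1} z \<partial>lborel)"
    unfolding emeasure_cone_slab[OF assms(1-3)]
  proof (rule nn_integral_cong)
    fix z :: real
    let ?I = "\<integral>\<^sup>+r. ennreal (hi r z - lo r z) * ennreal (r ^ (?d - 1) / fact (?d - 1)) * indicator {0..1} r \<partial>lborel"
    have "?I = ennreal (w z)" if z: "z \<in> {0..1}"
    proof -
      have "?I = (\<integral>\<^sup>+r. ennreal ((hi r z - lo r z) * (r ^ (?d - 1) / fact (?d - 1))) * indicator {0..1} r \<partial>lborel)"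
        using le z by (intro nn_integral_cong) (auto simp: indicator_def simp flip: ennreal_mult)
      also have "\<dots> = ennreal (w z)"
        using inner[OF z] by (intro nn_integral_has_integral_lebesgue') (use le z in auto)
      finally show ?thesis .
    qed
    \<comment> \<open>The two intervals differ at z = 0, where the positive power of
      \<open>z\<close> makes both sides vanish.\<close>
    then show "ennreal ((\<bar>c\<bar> * z) ^ ?d) * ?I * indicator {0<..1} z
        = ennreal (\<bar>c\<bar> ^ ?d * (z ^ ?d * w z)) * indicator {0..1} z"
      using w by (cases "z = 0") (auto simp: indicator_def power_mult_distrib mult.assoc simp flip: ennreal_mult)
  qed
  also have "\<dots> = ennreal (\<bar>c\<bar> ^ ?d * J)"
    using w by (intro nn_integral_has_integral_lebesgue' has_integral_mult_right outer) auto
  finally show ?thesis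
    using J by (simp add: measure_def)
qed

section \<open>Moments on the unit interval and closed formulas for the two volumes\<close>

lemma has_integral_power_div_fact:
  "((\<lambda>r::real. r ^ m / fact m) has_integral 1 / fact (Suc m)) {0..1}"
proof -
  have "((\<lambda>r::real. r ^ m / fact m) has_integral 1 ^ Suc m / fact (Suc m) - 0 ^ Suc m / fact (Suc m)) {0..1}"
    by (rule fundamental_theorem_of_calculus)
      (use deriv_power_div_fact in \<open>auto simp flip: has_real_derivative_iff_has_vector_derivative\<close>)
  then show ?thesis by simp
qed

lemma has_integral_mult_power_div_fact:
  "((\<lambda>r::real. r * (r ^ m / fact m)) has_integral real (Suc m) / fact (Suc (Suc m))) {0..1}"
proof -
  have "((\<lambda>r::real. real (Suc m) * (r ^ Suc m / fact (Suc m))) has_integral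
      real (Suc m) * (1 / fact (Suc (Suc m)))) {0..1}"
    by (rule has_integral_mult_right[OF has_integral_power_div_fact])
  then show ?thesis by (simp del: of_nat_Suc)
qed

lemma has_integral_power: "((\<lambda>z::real. z ^ m) has_integral 1 / real (Suc m)) {0..1}"
  using has_integral_mult_right[OF has_integral_power_div_fact[of m], of "fact m"] by simp

text \<open>An affine function integrates over a simplex to the volume times the mean of its vertex
  values; here there are m + 2 vertices, the volume is 1 / (m+1)!, and one vertex has value e^s - 1,
  the others e^(s+c) - 1.\<close>

lemma has_integral_upper_height:
  "((\<lambda>r. upper_height s c r z * (r ^ m / fact m)) has_integral
     z * (exp s * (1 + real (Suc m) * exp c) / fact (Suc (Suc m)) - 1 / fact (Suc m))) {0..1}"
proof -
  have "((\<lambda>r. z * (exp s - 1) * (r ^ m / fact m) + z * exp s * (exp c - 1) * (r * (r ^ m / fact m))) has_integral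
      z * (exp s - 1) * (1 / fact (Suc m)) + z * exp s * (exp c - 1) * (real (Suc m) / fact (Suc (Suc m)))) {0..1}"
    by (intro has_integral_add has_integral_mult_right has_integral_power_div_fact has_integral_mult_power_div_fact)
  moreover have "z * (exp s - 1) * (r ^ m / fact m) + z * exp s * (exp c - 1) * (r * (r ^ m / fact m))
      = upper_height s c r z * (r ^ m / fact m)" for r
  proof -
    have "z * (exp s - 1) * q + z * exp s * (exp c - 1) * (r * q) = upper_height s c r z * q" for q
      by (simp add: upper_height_def algebra_simps)
    then show ?thesis .
  qed
  moreover have "z * (exp s - 1) * (1 / fact (Suc m)) + z * exp s * (exp c - 1) * (real (Suc m) / fact (Suc (Suc m)))
      = z * (exp s * (1 + real (Suc m) * exp c) / fact (Suc (Suc m)) - 1 / fact (Suc m))"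
  proof -
    \<comment> \<open>Opaque names keep the factorials folded; the identity used is 1 / (m+1)! =
      (m+2) / (m+2)!.\<close>
    define D k where "D = (fact (Suc (Suc m)) :: real)" and "k = real (Suc m)"
    have "1 / fact (Suc m) = (k + 1) / D" "D \<noteq> 0"
      by (auto simp: D_def k_def fact_Suc[of "Suc m"] simp del: fact_Suc)
    then show ?thesis
      unfolding D_def[symmetric] k_def[symmetric] by (simp only:) (simp add: field_simps)
  qed
  ultimately show ?thesis
    by (simp only:)
qed

text \<open>The quantity N of the overview, with d = \<open>Suc m\<close>. It is never evaluated:
  two bounds show that it is negligible.\<close>

definition naive_moment :: "nat \<Rightarrow> real \<Rightarrow> real \<Rightarrow> real" where
  "naive_moment m s c = integral {0..1} (\<lambda>z. z ^ Suc m * (exp (z * s) * exp_moment m (z * c)))"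

lemma has_integral_naive_moment:
  "((\<lambda>z. z ^ Suc m * (exp (z * s) * exp_moment m (z * c))) has_integral naive_moment m s c) {0..1}"
  unfolding naive_moment_def
  by (intro integrable_integral integrable_continuous_real continuous_intros
      continuous_on_compose2[OF continuous_on_exp_moment]) auto

text \<open>The upper height is linear in \<open>z\<close> and gives the factor 1 / (m+3) after
  integration against z^(m+1). The constant -1 in the lower height has no factor \<open>z\<close>,
  hence the separate term with 1 / (m+2).\<close>

lemma volume_naive_relax:
  fixes v :: "real^'n"
  assumes c: "c \<noteq> 0" and d: "CARD('n) = Suc m"
  defines "s \<equiv> \<Sum>i\<in>UNIV. v $ i"
  shows "measure lborel (naive_relax expf (corner_vertices v c)) = \<bar>c\<bar> ^ Suc m *
    ((exp s * (1 + real (Suc m) * exp c) / fact (Suc (Suc m)) - 1 / fact (Suc m)) / real (m + 3)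
      + 1 / (fact (Suc m) * real (m + 2)) - naive_moment m s c)"
proof -
  let ?K = "exp s * (1 + real (Suc m) * exp c) / fact (Suc (Suc m)) - 1 / fact (Suc m)"
  have "measure lborel (cone_slab v c (naive_height s c) (upper_height s c)) = \<bar>c\<bar> ^ CARD('n) *
    (?K * (1 / real (Suc (Suc (Suc m)))) - (naive_moment m s c - 1 / fact (Suc m) * (1 / real (Suc (Suc m)))))"
  proof (rule measure_cone_slab[OF c])
    fix z :: real
    have "((\<lambda>r. upper_height s c r z * (r ^ m / fact m) -
        (exp (z * s) * (exp (z * c * r) * (r ^ m / fact m)) - r ^ m / fact m)) has_integral
        z * ?K - (exp (z * s) * exp_moment m (z * c) - 1 / fact (Suc m))) {0..1}"
      by (intro has_integral_diff has_integral_mult_right has_integral_upper_height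
          has_integral_exp_moment has_integral_power_div_fact)
    then show "((\<lambda>r. (upper_height s c r z - naive_height s c r z) * (r ^ (CARD('n) - 1) / fact (CARD('n) - 1)))
        has_integral z * ?K - (exp (z * s) * exp_moment m (z * c) - 1 / fact (Suc m))) {0..1}"
      by (simp add: d naive_height_def exp_add algebra_simps)
  next
    have "((\<lambda>z. ?K * z ^ Suc (Suc m) - (z ^ Suc m * (exp (z * s) * exp_moment m (z * c)) - 1 / fact (Suc m) * z ^ Suc m))
      has_integral ?K * (1 / real (Suc (Suc (Suc m)))) - (naive_moment m s c - 1 / fact (Suc m) * (1 / real (Suc (Suc m))))) {0..1}"
      by (intro has_integral_diff has_integral_mult_right has_integral_power has_integral_naive_moment)
    moreover have "?K * z ^ Suc (Suc m) - (z ^ Suc m * (exp (z * s) * exp_moment m (z * c)) - 1 / fact (Suc m) * z ^ Suc m)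
       = z ^ CARD('n) * (z * ?K - (exp (z * s) * exp_moment m (z * c) - 1 / fact (Suc m)))" for z
      unfolding d power_Suc2[of z "Suc m"] by (simp only: right_diff_distrib mult_ac)
    ultimately show "((\<lambda>z. z ^ CARD('n) * (z * ?K - (exp (z * s) * exp_moment m (z * c) - 1 / fact (Suc m))))
      has_integral ?K * (1 / real (Suc (Suc (Suc m)))) - (naive_moment m s c - 1 / fact (Suc m) * (1 / real (Suc (Suc m))))) {0..1}"
      by (simp only:)
  next
    fix r z :: real assume "r \<in> {0..1}" "z \<in> {0..1}"
    then show "naive_height s c r z \<le> upper_height s c r z"
      using order_trans[OF naive_height_le_persp_height persp_height_le_upper_height] by simp
  qed measurable
  then show ?thesis
    unfolding measure_naive_relax[OF c] s_def[symmetric] d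
    by (simp add: eval_nat_numeral del: of_nat_Suc fact_Suc)
qed

text \<open>Both heights are linear in \<open>z\<close>, so 1 / (m+3) is the common factor and the
  contributions of the constant -1 cancel.\<close>

lemma volume_persp_relax:
  fixes v :: "real^'n"
  assumes c: "c \<noteq> 0" and d: "CARD('n) = Suc m"
  defines "s \<equiv> \<Sum>i\<in>UNIV. v $ i"
  shows "measure lborel (persp_relax expf (corner_vertices v c)) = \<bar>c\<bar> ^ Suc m *
    ((exp s * (1 + real (Suc m) * exp c) / fact (Suc (Suc m)) - exp s * exp_moment m c) / real (m + 3))"
proof -
  let ?K = "exp s * (1 + real (Suc m) * exp c) / fact (Suc (Suc m)) - exp s * exp_moment m c"
  have "measure lborel (cone_slab v c (persp_height s c) (upper_height s c)) = \<bar>c\<bar> ^ CARD('n) *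
    (?K * (1 / real (Suc (Suc (Suc m)))))"
  proof (rule measure_cone_slab[OF c])
    fix z :: real
    have "((\<lambda>r. upper_height s c r z * (r ^ m / fact m) -
        z * (exp s * (exp (c * r) * (r ^ m / fact m)) - r ^ m / fact m)) has_integral
        z * (exp s * (1 + real (Suc m) * exp c) / fact (Suc (Suc m)) - 1 / fact (Suc m))
         - z * (exp s * exp_moment m c - 1 / fact (Suc m))) {0..1}"
      by (intro has_integral_diff has_integral_mult_right has_integral_upper_height
          has_integral_exp_moment has_integral_power_div_fact)
    then show "((\<lambda>r. (upper_height s c r z - persp_height s c r z) * (r ^ (CARD('n) - 1) / fact (CARD('n) - 1)))
        has_integral z * ?K) {0..1}"
      by (simp add: d persp_height_def exp_add algebra_simps del: fact_Suc)
  next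
    have "((\<lambda>z. ?K * z ^ Suc (Suc m)) has_integral ?K * (1 / real (Suc (Suc (Suc m))))) {0..1}"
      by (intro has_integral_mult_right has_integral_power)
    then show "((\<lambda>z. z ^ CARD('n) * (z * ?K)) has_integral ?K * (1 / real (Suc (Suc (Suc m))))) {0..1}"
      by (simp add: d mult_ac del: fact_Suc)
  next
    fix r z :: real assume "r \<in> {0..1}" "z \<in> {0..1}"
    then show "persp_height s c r z \<le> upper_height s c r z"
      using persp_height_le_upper_height by simp
  qed measurable
  then show ?thesis
    unfolding measure_persp_relax[OF c] s_def[symmetric] d
    by (simp add: eval_nat_numeral del: of_nat_Suc fact_Suc)
qed

subsection \<open>Asymptotics\<close>

lemma naive_moment_nonneg: "0 \<le> naive_moment m s c"
  by (rule has_integral_nonneg[OF has_integral_naive_moment]) (auto simp: exp_moment_nonneg)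

text \<open>The powers of \<open>u\<close> and \<open>z\<close> merge into (z u)^(m+1), exactly what
  \<open>exp_moment_minus_le\<close> absorbs; e^(z s) remains to be integrated.\<close>

lemma naive_moment_minus_le:
  assumes "0 \<le> u" "0 < s"
  shows "u ^ Suc m * naive_moment m s (- u) \<le> exp s / s"
proof -
  have "u ^ Suc m * naive_moment m s (- u) \<le> (exp s - 1) / s"
  proof (rule has_integral_le[OF has_integral_mult_right[OF has_integral_naive_moment] has_integral_exp_linear])
    fix z :: real assume z: "z \<in> {0..1}"
    have "(z * u) ^ Suc m * exp_moment m (- (z * u)) * exp (z * s) \<le> 1 * exp (z * s)"
      using z assms by (intro mult_right_mono exp_moment_minus_le) auto
    then show "u ^ Suc m * (z ^ Suc m * (exp (z * s) * exp_moment m (z * - u))) \<le> exp (s * z)"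
      unfolding power_mult_distrib by (simp only: mult_minus_right mult_1_left mult_ac)
  qed (use assms in auto)
  also have "\<dots> \<le> exp s / s"
    using assms by (intro divide_right_mono) auto
  finally show ?thesis .
qed

text \<open>One factor \<open>z\<close> is spent on \<open>exp_moment_le\<close>, which yields the
  first 1 / u; integrating the remaining e^(u z) yields the second.\<close>

lemma naive_moment_le:
  assumes "0 < u" "0 \<le> s"
  shows "naive_moment m s u \<le> exp s * exp u / u\<^sup>2"
proof -
  have "naive_moment m s u \<le> exp s / u * ((exp u - 1) / u)"
  proof (rule has_integral_le[OF has_integral_naive_moment has_integral_mult_right[OF has_integral_exp_linear]])
    fix z :: real assume z: "z \<in> {0..1}"
    have "u * (z * exp_moment m (z * u)) \<le> exp (u * z)"
      using exp_moment_le[of "z * u" m] z assms by (cases "z = 0") (auto simp: mult_ac)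
    then have *: "z * exp_moment m (z * u) \<le> exp (u * z) / u"
      using assms by (simp add: field_simps)
    have "z ^ Suc m * (exp (z * s) * exp_moment m (z * u)) \<le> z * (exp s * exp_moment m (z * u))"
    proof (intro mult_mono)
      show "z ^ Suc m \<le> z"
        using z by (simp add: mult_left_le power_le_one)
      show "exp (z * s) \<le> exp s"
        using z assms by (simp add: mult_left_le_one_le)
    qed (use z in \<open>auto simp: exp_moment_nonneg\<close>)
    also have "\<dots> \<le> exp s / u * exp (u * z)"
      using mult_left_mono[OF *, of "exp s"] by (simp add: mult_ac)
    finally show "z ^ Suc m * (exp (z * s) * exp_moment m (z * u)) \<le> exp s / u * exp (u * z)" .
  qed (use assms in auto)
  also have "\<dots> \<le> exp s * exp u / u\<^sup>2"
    using assms by (simp add: power2_eq_square divide_right_mono)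
  finally show ?thesis .
qed

text \<open>The powers of |c| cancel in the quotient, and the upper heights cancel in its numerator.
  The constant \<kappa> collects what the shift by -1 contributes to both.\<close>

lemma rel_gap_corner:
  fixes v :: "real^'n"
  assumes c: "c \<noteq> 0" and d: "CARD('n) = Suc m"
  defines "s \<equiv> \<Sum>i\<in>UNIV. v $ i"
  defines "\<kappa> \<equiv> 1 / (fact (Suc m) * real (m + 2)) - 1 / (fact (Suc m) * real (m + 3))"
  shows "rel_gap expf (corner_vertices v c) =
    (exp s * exp_moment m c / real (m + 3) + \<kappa> - naive_moment m s c) /
    (exp s * (1 + real (Suc m) * exp c) / (fact (Suc (Suc m)) * real (m + 3)) + \<kappa> - naive_moment m s c)"
proof -
  let ?K = "exp s * (1 + real (Suc m) * exp c) / fact (Suc (Suc m))"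
  let ?N = "naive_moment m s c"
  let ?P = "exp s * exp_moment m c"
  let ?den = "(?K - 1 / fact (Suc m)) / real (m + 3) + 1 / (fact (Suc m) * real (m + 2)) - ?N"
  have "rel_gap expf (corner_vertices v c) =
      (\<bar>c\<bar> ^ Suc m * ?den - \<bar>c\<bar> ^ Suc m * ((?K - ?P) / real (m + 3))) / (\<bar>c\<bar> ^ Suc m * ?den)"
    unfolding rel_gap_def volume_naive_relax[OF c d] volume_persp_relax[OF c d] s_def[symmetric] ..
  also have "\<dots> = (?den - (?K - ?P) / real (m + 3)) / ?den"
    unfolding right_diff_distrib[symmetric] using c by (intro mult_divide_mult_cancel_left) simp
  also have "?den - (?K - ?P) / real (m + 3) = ?P / real (m + 3) + \<kappa> - ?N"
    unfolding \<kappa>_def by (simp add: diff_divide_distrib)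
  also have "?den = ?K / real (m + 3) + \<kappa> - ?N"
    unfolding \<kappa>_def by (simp only: diff_divide_distrib divide_divide_eq_left)
  finally show ?thesis by (simp only: divide_divide_eq_left)
qed

text \<open>After division by e^(a u) the numerator, scaled by u^(m+1), tends to 1 / (m+3) and the
  denominator to 1 / ((m+2)! (m+3)).\<close>

lemma rel_gap_shrinking_corner:
  fixes v :: "real \<Rightarrow> real^'n"
  assumes d: "CARD('n) = Suc m" and a: "0 < a" and s: "\<And>u. (\<Sum>i\<in>UNIV. v u $ i) = a * u"
  shows "((\<lambda>u. u ^ Suc m * rel_gap expf (corner_vertices (v u) (- u))) \<longlongrightarrow> fact (Suc (Suc m))) at_top"
proof -
  define \<kappa> where "\<kappa> = 1 / (fact (Suc m) * real (m + 2)) - 1 / (fact (Suc m) * real (m + 3))"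
  define N where "N u = naive_moment m (a * u) (- u)" for u
  define num where "num u = u ^ Suc m * exp_moment m (- u) / real (m + 3) + \<kappa> * (u ^ Suc m / exp (a * u))
      - u ^ Suc m * N u / exp (a * u)" for u
  define den where "den u = (1 + real (Suc m) * exp (- u)) / (fact (Suc (Suc m)) * real (m + 3))
      + \<kappa> * (1 / exp (a * u)) - N u / exp (a * u)" for u
  have N: "((\<lambda>u. u ^ Suc m * N u / exp (a * u)) \<longlongrightarrow> 0) at_top"
  proof (rule tendsto_sandwich[of "\<lambda>_. 0" _ _ "\<lambda>u. 1 / (a * u)"])
    show "eventually (\<lambda>u. 0 \<le> u ^ Suc m * N u / exp (a * u)) at_top"
      using eventually_gt_at_top[of "0::real"]
      by eventually_elim (auto simp: N_def naive_moment_nonneg)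
    show "eventually (\<lambda>u. u ^ Suc m * N u / exp (a * u) \<le> 1 / (a * u)) at_top"
      using eventually_gt_at_top[of "0::real"]
    proof eventually_elim
      case (elim u)
      then show ?case
        using naive_moment_minus_le[of u "a * u" m] a by (simp add: N_def divide_le_eq)
    qed
    show "((\<lambda>u. 1 / (a * u)) \<longlongrightarrow> 0) at_top"
      using a by real_asymp
  qed simp
  \<comment> \<open>For u >= 1 this is dominated by the previous limit, since the power of
    \<open>u\<close> is then at least 1.\<close>
  have N': "((\<lambda>u. N u / exp (a * u)) \<longlongrightarrow> 0) at_top"
  proof (rule tendsto_sandwich[OF _ _ tendsto_const N])
    show "eventually (\<lambda>u. 0 \<le> N u / exp (a * u)) at_top"
      by (auto simp: N_def naive_moment_nonneg)
    show "eventually (\<lambda>u. N u / exp (a * u) \<le> u ^ Suc m * N u / exp (a * u)) at_top"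
      using eventually_ge_at_top[of "1::real"]
    proof eventually_elim
      case (elim u)
      have "1 * N u \<le> u ^ Suc m * N u"
        using elim by (intro mult_right_mono one_le_power) (auto simp: N_def naive_moment_nonneg)
      then show ?case by (simp add: divide_right_mono)
    qed
  qed
  have "(num \<longlongrightarrow> 1 / real (m + 3) + \<kappa> * 0 - 0) at_top"
    unfolding num_def
  proof (intro tendsto_add tendsto_diff tendsto_mult N tendsto_const tendsto_divide exp_moment_minus_tendsto)
    show "((\<lambda>u. u ^ Suc m / exp (a * u)) \<longlongrightarrow> 0) at_top"
      using a by real_asymp
  qed auto
  moreover have "(den \<longlongrightarrow> (1 + real (Suc m) * 0) / (fact (Suc (Suc m)) * real (m + 3)) + \<kappa> * 0 - 0) at_top"
    unfolding den_def
  proof (intro tendsto_add tendsto_diff tendsto_mult N' tendsto_const tendsto_divide)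
    show "((\<lambda>u. 1 / exp (a * u)) \<longlongrightarrow> 0) at_top"
      using a by real_asymp
    show "((\<lambda>u::real. exp (- u)) \<longlongrightarrow> 0) at_top"
      by real_asymp
  qed auto
  ultimately have "((\<lambda>u. num u / den u) \<longlongrightarrow> (1 / real (m + 3) + \<kappa> * 0 - 0) /
      ((1 + real (Suc m) * 0) / (fact (Suc (Suc m)) * real (m + 3)) + \<kappa> * 0 - 0)) at_top"
    by (rule tendsto_divide) (simp del: fact_Suc)
  also have "(1 / real (m + 3) + \<kappa> * 0 - 0) /
      ((1 + real (Suc m) * 0) / (fact (Suc (Suc m)) * real (m + 3)) + \<kappa> * 0 - 0) = fact (Suc (Suc m))"
    by (simp del: fact_Suc)
  finally have lim: "((\<lambda>u. num u / den u) \<longlongrightarrow> fact (Suc (Suc m))) at_top" .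
  have "eventually (\<lambda>u. num u / den u = u ^ Suc m * rel_gap expf (corner_vertices (v u) (- u))) at_top"
    using eventually_gt_at_top[of "0::real"]
  proof eventually_elim
    case (elim u)
    let ?e = "exp (a * u)"
    let ?n = "?e * exp_moment m (- u) / real (m + 3) + \<kappa> - N u"
    let ?d = "?e * (1 + real (Suc m) * exp (- u)) / (fact (Suc (Suc m)) * real (m + 3)) + \<kappa> - N u"
    have "rel_gap expf (corner_vertices (v u) (- u)) = ?n / ?d"
      using elim by (subst rel_gap_corner[OF _ d]) (auto simp: s N_def \<kappa>_def simp del: fact_Suc)
    moreover have "num u = u ^ Suc m * ?n / ?e"
    proof -
      \<comment> \<open>Stated for arbitrary reals so that simplification does not rewrite inside
        the moments and exponentials.\<close>
      have "p * q / x + \<kappa> * (p / e) - p * n / e = p * (e * q / x + \<kappa> - n) / e"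
        if "e \<noteq> 0" "x \<noteq> 0" for p q x e n :: real
        using that by (simp add: field_simps)
      then show ?thesis unfolding num_def by simp
    qed
    moreover have "den u = ?d / ?e"
      by (simp add: den_def diff_divide_distrib add_divide_distrib del: fact_Suc)
    ultimately show ?case by simp
  qed
  with lim show ?thesis
    by (rule Lim_transform_eventually)
qed

text \<open>The normalization is now e^(s+u), of the order of the largest vertex value. The
  numerator, scaled by \<open>u\<close>, tends to 1 / (m! (m+3)) and the denominator to (m+1) /
  ((m+2)! (m+3)).\<close>

lemma rel_gap_growing_corner:
  fixes v :: "real^'n"
  assumes d: "CARD('n) = Suc m" and s_nonneg: "0 \<le> (\<Sum>i\<in>UNIV. v $ i)"
  shows "((\<lambda>u. u * rel_gap expf (corner_vertices v u)) \<longlongrightarrow> real (Suc (Suc m))) at_top"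
proof -
  define s where "s = (\<Sum>i\<in>UNIV. v $ i)"
  define \<kappa> where "\<kappa> = 1 / (fact (Suc m) * real (m + 2)) - 1 / (fact (Suc m) * real (m + 3))"
  define N where "N u = naive_moment m s u" for u
  define num where "num u = u * exp_moment m u / exp u / real (m + 3) + \<kappa> * (u / exp (s + u))
      - u * N u / exp (s + u)" for u
  define den where "den u = (exp (- u) + real (Suc m)) / (fact (Suc (Suc m)) * real (m + 3))
      + \<kappa> * (1 / exp (s + u)) - N u / exp (s + u)" for u
  have N: "((\<lambda>u. u * N u / exp (s + u)) \<longlongrightarrow> 0) at_top"
  proof (rule tendsto_sandwich[of "\<lambda>_. 0" _ _ "\<lambda>u. 1 / u"])
    show "eventually (\<lambda>u. 0 \<le> u * N u / exp (s + u)) at_top"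
      using eventually_gt_at_top[of "0::real"]
      by eventually_elim (auto simp: N_def naive_moment_nonneg)
    show "eventually (\<lambda>u. u * N u / exp (s + u) \<le> 1 / u) at_top"
      using eventually_gt_at_top[of "0::real"]
    proof eventually_elim
      case (elim u)
      then have "u * N u \<le> u * (exp s * exp u / u\<^sup>2)"
        unfolding N_def using s_nonneg by (intro mult_left_mono naive_moment_le) (auto simp: s_def)
      then show ?case
        using elim by (simp add: exp_add divide_simps power2_eq_square)
    qed
    show "((\<lambda>u::real. 1 / u) \<longlongrightarrow> 0) at_top"
      by real_asymp
  qed simp
  have N': "((\<lambda>u. N u / exp (s + u)) \<longlongrightarrow> 0) at_top"
  proof (rule tendsto_sandwich[OF _ _ tendsto_const N])
    show "eventually (\<lambda>u. 0 \<le> N u / exp (s + u)) at_top"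
      by (auto simp: N_def naive_moment_nonneg)
    show "eventually (\<lambda>u. N u / exp (s + u) \<le> u * N u / exp (s + u)) at_top"
      using eventually_ge_at_top[of "1::real"]
    proof eventually_elim
      case (elim u)
      have "1 * N u \<le> u * N u"
        using elim by (intro mult_right_mono) (auto simp: N_def naive_moment_nonneg)
      then show ?case by (simp add: divide_right_mono)
    qed
  qed
  have "(num \<longlongrightarrow> 1 / fact m / real (m + 3) + \<kappa> * 0 - 0) at_top"
    unfolding num_def
  proof (intro tendsto_add tendsto_diff tendsto_mult N tendsto_const)
    show "((\<lambda>u. u * exp_moment m u / exp u / real (m + 3)) \<longlongrightarrow> 1 / fact m / real (m + 3)) at_top"
      by (rule tendsto_divide[OF exp_moment_tendsto tendsto_const]) simp
    show "((\<lambda>u. u / exp (s + u)) \<longlongrightarrow> 0) at_top"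
      by real_asymp
  qed
  moreover have "(den \<longlongrightarrow> (0 + real (Suc m)) / (fact (Suc (Suc m)) * real (m + 3)) + \<kappa> * 0 - 0) at_top"
    unfolding den_def
  proof (intro tendsto_add tendsto_diff tendsto_mult N' tendsto_const tendsto_divide)
    show "((\<lambda>u. 1 / exp (s + u)) \<longlongrightarrow> 0) at_top"
      by real_asymp
    show "((\<lambda>u::real. exp (- u)) \<longlongrightarrow> 0) at_top"
      by real_asymp
  qed auto
  ultimately have "((\<lambda>u. num u / den u) \<longlongrightarrow> (1 / fact m / real (m + 3) + \<kappa> * 0 - 0) /
      ((0 + real (Suc m)) / (fact (Suc (Suc m)) * real (m + 3)) + \<kappa> * 0 - 0)) at_top"
    by (rule tendsto_divide) (simp del: fact_Suc of_nat_Suc)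
  also have "(1 / fact m / real (m + 3) + \<kappa> * 0 - 0) /
      ((0 + real (Suc m)) / (fact (Suc (Suc m)) * real (m + 3)) + \<kappa> * 0 - 0) = real (Suc (Suc m))"
  proof -
    \<comment> \<open>Used with l = m + 2, k = m + 1 and f = m!, so that l k f = (m+2)!.\<close>
    have "1 / f / x / (k / (l * (k * f) * x)) = l" if "f \<noteq> 0" "x \<noteq> 0" "k \<noteq> 0" for f x k l :: real
      using that by simp
    from this[of "fact m" "real (m + 3)" "real (Suc m)" "real (Suc (Suc m))"] show ?thesis
      by (simp only: fact_Suc mult_zero_right add_0_left add_0_right diff_0_right) simp
  qed
  finally have lim: "((\<lambda>u. num u / den u) \<longlongrightarrow> real (Suc (Suc m))) at_top" .
  have "eventually (\<lambda>u. num u / den u = u * rel_gap expf (corner_vertices v u)) at_top"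
    using eventually_gt_at_top[of "0::real"]
  proof eventually_elim
    case (elim u)
    let ?n = "exp s * exp_moment m u / real (m + 3) + \<kappa> - N u"
    let ?d = "exp s * (1 + real (Suc m) * exp u) / (fact (Suc (Suc m)) * real (m + 3)) + \<kappa> - N u"
    have "rel_gap expf (corner_vertices v u) = ?n / ?d"
      using elim by (subst rel_gap_corner[OF _ d]) (auto simp: s_def N_def \<kappa>_def simp del: fact_Suc)
    moreover have "num u = u * ?n / exp (s + u)"
    proof -
      have "u * q / e / x + \<kappa> * (u / (e' * e)) - u * n / (e' * e) = u * (e' * q / x + \<kappa> - n) / (e' * e)"
        if "e \<noteq> 0" "e' \<noteq> 0" "x \<noteq> 0" for q x e e' n :: real
        using that by (simp add: field_simps)
      then show ?thesis unfolding num_def exp_add by simp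
    qed
    moreover have "den u = ?d / exp (s + u)"
    proof -
      have "exp (- u) + real (Suc m) = exp s * (1 + real (Suc m) * exp u) / exp (s + u)"
        by (simp add: exp_add exp_minus field_simps)
      then show ?thesis
        by (simp add: den_def diff_divide_distrib add_divide_distrib del: fact_Suc of_nat_Suc)
    qed
    ultimately show ?case by simp
  qed
  with lim show ?thesis
    by (rule Lim_transform_eventually)
qed

theorem theorem14:
  shows
   "(\<forall>k::real. k > 0 \<longrightarrow>
       ((\<lambda>u::real. u ^ CARD('n) *
          rel_gap (expf :: real^'n \<Rightarrow> real)
            (insert (\<chi> i. k * u)
               ((\<lambda>j. (\<chi> i. k * u) - u *\<^sub>R axis j 1) ` UNIV)))
        \<longlongrightarrow> fact (CARD('n) + 1)) at_top)
    \<and> (\<forall>v0::real^'n. (\<forall>i. 0 \<le> v0 $ i) \<and> v0 \<noteq> 0 \<longrightarrow>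
       ((\<lambda>u::real. u *
          rel_gap (expf :: real^'n \<Rightarrow> real)
            (insert v0 ((\<lambda>j. v0 + u *\<^sub>R axis j 1) ` UNIV)))
        \<longlongrightarrow> real (CARD('n) + 1)) at_top)"
proof -
  obtain m where d: "CARD('n) = Suc m"
    using not0_implies_Suc[of "CARD('n)"] by auto
  show ?thesis
  proof (intro conjI allI impI)
    \<comment> \<open>The apex has coordinate sum d k u, so the growth rate \<open>a\<close> is d k;
      the edges have c = -u.\<close>
    fix k :: real assume "0 < k"
    then show "((\<lambda>u::real. u ^ CARD('n) *
          rel_gap (expf :: real^'n \<Rightarrow> real)
            (insert (\<chi> i. k * u)
               ((\<lambda>j. (\<chi> i. k * u) - u *\<^sub>R axis j 1) ` UNIV)))
        \<longlongrightarrow> fact (CARD('n) + 1)) at_top"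
      using rel_gap_shrinking_corner[OF d, of "real (Suc m) * k" "\<lambda>u. \<chi> i. k * u"]
      by (simp add: d mult.assoc del: fact_Suc of_nat_Suc power_Suc)
  next
    fix v0 :: "real^'n" assume "(\<forall>i. 0 \<le> v0 $ i) \<and> v0 \<noteq> 0"
    then show "((\<lambda>u::real. u *
          rel_gap (expf :: real^'n \<Rightarrow> real)
            (insert v0 ((\<lambda>j. v0 + u *\<^sub>R axis j 1) ` UNIV)))
        \<longlongrightarrow> real (CARD('n) + 1)) at_top"
      using rel_gap_growing_corner[OF d, of v0] by (simp add: d sum_nonneg)
  qed
qed

end
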